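(* Let $E$ be a theme and let $F\subset E$ be a monogenic sub-$\tilde{\mathcal A}$-module of $E$. Then $F$ is a theme. Moreover, if $F$ is normal in $E$, then the quotient $E/F$ is also a theme.
   Context: $\tilde{\mathcal A}$ denotes the $\mathbb C$-algebra of formal series $\sum_{\nu\ge0}P_\nu(a)b^\nu$ with $P_\nu\in\mathbb C[z]$, whose product is determined by the commutation relation $ab-ba=b^2$ and by the continuity of left and right multiplication by $a$ for the $b$-adic topology; it contains $\mathbb C[[b]]$. An (a,b)-module is a left $\tilde{\mathcal A}$-module which is free of finite rank over $\mathbb C[[b]]$; its rank is its $\mathbb C[[b]]$-rank. A module is monogenic if it is generated as a left $\tilde{\mathcal A}$-module by one element. A sub-(a,b)-module $F\subset E$ is normal if $F\cap bE=bF$ (equivalently $E/F$ is again an (a,b)-module). For a rational $\lambda\in\,]0,1]$ let $\Xi_\lambda=\bigoplus_{j\ge0}\mathbb C[[b]]e_{\lambda,j}$ (finite sums; think of $e_{\lambda,j}=s^{\lambda-1}(\log s)^j/j!$, with $a$ = multiplication by $s$ and $b$ = primitive vanishing at $0$), where $a$ is defined by $ae_{\lambda,0}=\lambda be_{\lambda,0}$, $ae_{\lambda,j}=\lambda be_{\lambda,j}+be_{\lambda,j-1}$ for $j\ge1$, extended via $aS(b)=S(b)a+b^2S'(b)$ for $S\in\mathbb C[[b]]$. Put $\Xi=\bigoplus_{\lambda\in\mathbb Q\cap]0,1]}\Xi_\lambda$, a left $\tilde{\mathcal A}$-module. A theme is a left $\tilde{\mathcal A}$-module isomorphic to $\tilde{\mathcal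 A}\varphi\subset\Xi$ for some $\varphi\in\Xi$. *)

theory Defs
  imports "HOL-Computational_Algebra.Polynomial" "HOL-Computational_Algebra.Formal_Power_Series"
begin

text \<open>A left module over the algebra A~ is recorded by its carrier, addition, zero,
  the action of C[[b]] (complex formal power series in b) and the action of a.
  For the modules at hand (isomorphic to submodules of Xi, free of finite rank over C[[b]])
  the full A~-action is determined by these data by b-adic continuity.\<close>

record 'm abmod =
  ab_carrier :: "'m set"
  ab_plus :: "'m \<Rightarrow> 'm \<Rightarrow> 'm"
  ab_zero :: 'm
  ab_bmul :: "complex fps \<Rightarrow> 'm \<Rightarrow> 'm"
  ab_aop :: "'m \<Rightarrow> 'm"

definition ab_closed :: "('m, 'z) abmod_scheme \<Rightarrow> bool" where
  "ab_closed M \<longleftrightarrow> ab_zero M \<in> ab_carrier M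
     \<and> (\<forall>x\<in>ab_carrier M. \<forall>y\<in>ab_carrier M. ab_plus M x y \<in> ab_carrier M)
     \<and> (\<forall>S. \<forall>x\<in>ab_carrier M. ab_bmul M S x \<in> ab_carrier M)
     \<and> (\<forall>x\<in>ab_carrier M. ab_aop M x \<in> ab_carrier M)"

text \<open>An element of Xi is a finitely supported family u indexed by (lambda, j), lambda rational
  in ]0,1], j a natural number, with u (lambda,j) the C[[b]]-coefficient of e_{lambda,j}.\<close>

type_synonym xi = "rat \<times> nat \<Rightarrow> complex fps"

definition Xi_set :: "xi set" where
  "Xi_set = {u. finite {k. u k \<noteq> 0} \<and> (\<forall>l j. u (l, j) \<noteq> 0 \<longrightarrow> 0 < l \<and> l \<le> 1)}"

definition Xi_plus :: "xi \<Rightarrow> xi \<Rightarrow> xi" where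
  "Xi_plus u v = (\<lambda>k. u k + v k)"

definition Xi_bmul :: "complex fps \<Rightarrow> xi \<Rightarrow> xi" where
  "Xi_bmul S u = (\<lambda>k. S * u k)"

text \<open>Action of a: a(S e_{l,j}) = l b S e_{l,j} + b S e_{l,j-1} + b^2 S' e_{l,j}
  (with e_{l,-1} = 0), so the coefficient of e_{l,j} in a u is
  l b u_{l,j} + b u_{l,j+1} + b^2 u'_{l,j}.\<close>
definition Xi_a :: "xi \<Rightarrow> xi" where
  "Xi_a u = (\<lambda>(l, j). fps_const (of_rat l) * fps_X * u (l, j) + fps_X * u (l, Suc j)
                       + fps_X ^ 2 * fps_deriv (u (l, j)))"

definition Xi_polyop :: "complex poly \<Rightarrow> xi \<Rightarrow> xi" where
  "Xi_polyop P u = (\<lambda>k. \<Sum>i\<le>degree P. fps_const (coeff P i) * (Xi_a ^^ i) u k)"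

text \<open>Action of the element sum_nu P_nu(a) b^nu of A~ on u in Xi; the nu-th term lies in
  b^nu Xi, so the b-adic sum is computed coefficientwise by a finite sum.\<close>
definition Atil_act :: "(nat \<Rightarrow> complex poly) \<Rightarrow> xi \<Rightarrow> xi" where
  "Atil_act P u = (\<lambda>k. Abs_fps (\<lambda>n. \<Sum>\<nu>\<le>n.
        fps_nth (Xi_polyop (P \<nu>) (Xi_bmul (fps_X ^ \<nu>) u) k) n))"

definition Atil_span :: "xi \<Rightarrow> xi set" where
  "Atil_span \<phi> = range (\<lambda>P. Atil_act P \<phi>)"

definition theme :: "('m, 'z) abmod_scheme \<Rightarrow> bool" where
  "theme M \<longleftrightarrow> ab_closed M \<and>
    (\<exists>\<phi>\<in>Xi_set. \<exists>f. bij_betw f (ab_carrier M) (Atil_span \<phi>)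
       \<and> f (ab_zero M) = (\<lambda>_. 0)
       \<and> (\<forall>x\<in>ab_carrier M. \<forall>y\<in>ab_carrier M. f (ab_plus M x y) = Xi_plus (f x) (f y))
       \<and> (\<forall>S. \<forall>x\<in>ab_carrier M. f (ab_bmul M S x) = Xi_bmul S (f x))
       \<and> (\<forall>x\<in>ab_carrier M. f (ab_aop M x) = Xi_a (f x)))"

definition is_sub :: "('m, 'z) abmod_scheme \<Rightarrow> 'm set \<Rightarrow> bool" where
  "is_sub E F \<longleftrightarrow> F \<subseteq> ab_carrier E \<and> ab_zero E \<in> F
     \<and> (\<forall>x\<in>F. \<forall>y\<in>F. ab_plus E x y \<in> F)
     \<and> (\<forall>S. \<forall>x\<in>F. ab_bmul E S x \<in> F)
     \<and> (\<forall>x\<in>F. ab_aop E x \<in> F)"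

definition generated :: "('m, 'z) abmod_scheme \<Rightarrow> 'm \<Rightarrow> 'm set" where
  "generated E x = \<Inter>{G. is_sub E G \<and> x \<in> G}"

definition monogenic :: "('m, 'z) abmod_scheme \<Rightarrow> 'm set \<Rightarrow> bool" where
  "monogenic E F \<longleftrightarrow> (\<exists>x\<in>F. F = generated E x)"

definition normal_sub :: "('m, 'z) abmod_scheme \<Rightarrow> 'm set \<Rightarrow> bool" where
  "normal_sub E F \<longleftrightarrow> F \<inter> (ab_bmul E fps_X ` ab_carrier E) = ab_bmul E fps_X ` F"

definition coset :: "('m, 'z) abmod_scheme \<Rightarrow> 'm set \<Rightarrow> 'm \<Rightarrow> 'm set" where
  "coset E F x = ab_plus E x ` F"

definition quotient :: "('m, 'z) abmod_scheme \<Rightarrow> 'm set \<Rightarrow> 'm set abmod" where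
  "quotient E F =
    \<lparr> ab_carrier = coset E F ` ab_carrier E,
      ab_plus = (\<lambda>X Y. coset E F (ab_plus E (SOME x. x \<in> X) (SOME y. y \<in> Y))),
      ab_zero = coset E F (ab_zero E),
      ab_bmul = (\<lambda>S X. coset E F (ab_bmul E S (SOME x. x \<in> X))),
      ab_aop = (\<lambda>X. coset E F (ab_aop E (SOME x. x \<in> X))) \<rparr>"

end

theory Submission
  imports Defs
begin

text \<open>Up to multiplication by powers of \<open>b\<close>, every submodule of \<open>Xi\<close> is a coordinate
  submodule, spanned by the \<open>e\<^sub>\<lambda>\<^sub>,\<^sub>j\<close> with \<open>j < m\<^sub>\<lambda>\<close>: the operator \<open>D = b\<inverse>a\<close> has the generalized
  eigenvalue \<open>\<lambda> + n\<close> on \<open>b\<^sup>n e\<^sub>\<lambda>\<^sub>,\<^sub>j\<close>, and these are distinct for distinct \<open>(\<lambda>, n)\<close> because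
  \<open>\<lambda> \<in> ]0,1]\<close>, so operators \<open>D - \<lambda> - n\<close> isolate basis vectors.
  Consequently a submodule of \<open>Xi\<close> with uniformly bounded support is \<open>b\<close>-adically closed, which
  identifies the submodule generated by \<open>\<psi>\<close> with the set of all \<open>\<Sum> P\<^sub>\<nu>(a) b\<^sup>\<nu> \<psi>\<close>.
  If \<open>F\<close> is normal in \<open>E = A\<phi>\<close>, it is the trace on \<open>E\<close> of a coordinate submodule, that is,
  of the kernel of the endomorphism \<open>T : e\<^sub>\<lambda>\<^sub>,\<^sub>j \<mapsto> e\<^sub>\<lambda>\<^sub>,\<^sub>j\<^sub>-\<^sub>m\<^sub>\<lambda>\<close> of \<open>Xi\<close>,
  and \<open>E/F\<close> is isomorphic to \<open>TE = A(T\<phi>)\<close>.\<close>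

section \<open>Submodules of Xi\<close>

definition xi_sub :: "xi set \<Rightarrow> bool" where
  "xi_sub G \<longleftrightarrow> (\<lambda>_. 0) \<in> G \<and> (\<forall>u\<in>G. \<forall>v\<in>G. Xi_plus u v \<in> G)
     \<and> (\<forall>S. \<forall>u\<in>G. Xi_bmul S u \<in> G) \<and> (\<forall>u\<in>G. Xi_a u \<in> G)"

lemma xi_subD:
  assumes "xi_sub G"
  shows "(\<lambda>_. 0) \<in> G"
    and "u \<in> G \<Longrightarrow> v \<in> G \<Longrightarrow> Xi_plus u v \<in> G"
    and "u \<in> G \<Longrightarrow> Xi_bmul S u \<in> G"
    and "u \<in> G \<Longrightarrow> Xi_a u \<in> G"
  using assms by (auto simp: xi_sub_def)

lemma xi_sub_sum:
  assumes "xi_sub G" "finite I" "\<And>i. i \<in> I \<Longrightarrow> u i \<in> G"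
  shows "(\<lambda>k. \<Sum>i\<in>I. u i k) \<in> G"
  using assms(2,3)
proof (induction I rule: finite_induct)
  case empty
  then show ?case using xi_subD(1)[OF assms(1)] by simp
next
  case (insert i I)
  then have "Xi_plus (u i) (\<lambda>k. \<Sum>i\<in>I. u i k) \<in> G"
    by (intro xi_subD(2)[OF assms(1)]) auto
  then show ?case using insert by (simp add: Xi_plus_def)
qed

text \<open>The derivation part of \<open>a\<close> sends \<open>b^m\<close> to
  \<open>m b^(m+1)\<close>, so \<open>a\<close> raises the order in \<open>b\<close> by at least
  one. The truncated \<open>n - 1\<close> forces the separate case \<open>n = 0\<close>.\<close>

lemma Xi_a_nth:
  "fps_nth (Xi_a u (l, j)) n = (if n = 0 then 0 else
     (of_rat l + of_nat (n - 1)) * fps_nth (u (l, j)) (n - 1) + fps_nth (u (l, Suc j)) (n - 1))"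
proof (cases n)
  case 0
  then show ?thesis
    by (simp add: Xi_a_def power2_eq_square mult.assoc fps_mult_nth_0)
next
  case (Suc m)
  have "fps_X ^ 2 * fps_deriv (u (l, j)) = fps_X * (fps_X * fps_deriv (u (l, j)))"
    by (simp add: power2_eq_square mult.assoc)
  then have "fps_nth (fps_X ^ 2 * fps_deriv (u (l, j))) (Suc m) = of_nat m * fps_nth (u (l, j)) m"
    by (simp only:) (cases m, simp_all del: fps_mult_fps_X_commute)
  then show ?thesis using Suc
    by (simp add: Xi_a_def mult.assoc distrib_right)
qed

lemma Xi_a_pow_mem: "xi_sub G \<Longrightarrow> u \<in> G \<Longrightarrow> (Xi_a ^^ i) u \<in> G"
  by (induction i) (auto simp: xi_subD)

lemma Xi_polyop_mem:
  assumes "xi_sub G" "u \<in> G"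
  shows "Xi_polyop P u \<in> G"
proof -
  have "(\<lambda>k. \<Sum>i\<in>{..degree P}. Xi_bmul (fps_const (coeff P i)) ((Xi_a ^^ i) u) k) \<in> G"
    using assms by (intro xi_sub_sum xi_subD(3) Xi_a_pow_mem) auto
  then show ?thesis by (simp add: Xi_polyop_def Xi_bmul_def)
qed

section \<open>Commutation of \<open>a\<close> with power series in \<open>b\<close>\<close>

lemma Xi_a_bmul:
  "Xi_a (Xi_bmul S u) = Xi_plus (Xi_bmul S (Xi_a u)) (Xi_bmul (fps_X\<^sup>2 * fps_deriv S) u)"
  by (rule ext) (auto simp: Xi_a_def Xi_bmul_def Xi_plus_def algebra_simps)

text \<open>Solved for the product with \<open>S\<close> on the left: stability under
  \<open>S\<close> passes from \<open>u\<close> to \<open>Xi_a u\<close> whenever the target is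
  already stable under \<open>a\<close> and addition.\<close>

lemma bmul_Xi_a:
  "Xi_bmul S (Xi_a u) = Xi_plus (Xi_a (Xi_bmul S u)) (Xi_bmul (- (fps_X\<^sup>2 * fps_deriv S)) u)"
  by (simp add: Xi_a_bmul) (simp add: Xi_bmul_def Xi_plus_def)

lemma Xi_bmul_bmul: "Xi_bmul S (Xi_bmul R u) = Xi_bmul (S * R) u"
  by (simp add: Xi_bmul_def mult.assoc)

lemma Xi_bmul_plus: "Xi_bmul S (Xi_plus u v) = Xi_plus (Xi_bmul S u) (Xi_bmul S v)"
  by (simp add: Xi_bmul_def Xi_plus_def distrib_left)

lemma Xi_bmul_1: "Xi_bmul 1 u = u"
  by (simp add: Xi_bmul_def)

lemma Xi_bmul_eq_iff: "S \<noteq> 0 \<Longrightarrow> Xi_bmul S u = Xi_bmul S v \<longleftrightarrow> u = v"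
  by (auto simp: Xi_bmul_def fun_eq_iff)

text \<open>The support is closed downwards in \<open>j\<close> because \<open>a\<close> passes
  coefficients from \<open>j + 1\<close> to \<open>j\<close>; families supported there therefore
  form a submodule. Its cardinality is also the induction measure for
  \<open>sat_basis\<close>.\<close>

definition down :: "xi \<Rightarrow> (rat \<times> nat) set" where
  "down u = {(l, i). \<exists>j\<ge>i. u (l, j) \<noteq> 0}"

lemma finite_down:
  assumes "u \<in> Xi_set"
  shows "finite (down u)"
proof -
  have "down u \<subseteq> (\<Union>(l, j)\<in>{k. u k \<noteq> 0}. {l} \<times> {..j})"
    by (force simp: down_def)
  moreover have "finite (\<Union>(l, j)\<in>{k. u k \<noteq> 0}. {l} \<times> {..j})"
    using assms by (auto simp: Xi_set_def)
  ultimately show ?thesis by (rule finite_subset)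
qed

lemma Xi_set_subsupp:
  assumes "u \<in> Xi_set" "\<And>k. k \<notin> down u \<Longrightarrow> v k = 0"
  shows "v \<in> Xi_set"
proof -
  have "{k. v k \<noteq> 0} \<subseteq> down u" using assms(2) by auto
  then have "finite {k. v k \<noteq> 0}" using finite_down[OF assms(1)] finite_subset by blast
  moreover have "0 < l \<and> l \<le> 1" if "v (l, j) \<noteq> 0" for l j
  proof -
    have "(l, j) \<in> down u" using that assms(2) by blast
    then show ?thesis using assms(1) by (auto simp: down_def Xi_set_def)
  qed
  ultimately show ?thesis by (auto simp: Xi_set_def)
qed

lemma down_support: "k \<notin> down u \<Longrightarrow> u k = 0"
  by (cases k) (auto simp: down_def)

lemma xi_sub_supported:
  assumes "\<And>l j. (l, Suc j) \<in> K \<Longrightarrow> (l, j) \<in> K"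
  shows "xi_sub {g. \<forall>k. k \<notin> K \<longrightarrow> g k = 0}"
  using assms by (auto simp: xi_sub_def Xi_plus_def Xi_bmul_def Xi_a_def)

lemma xi_sub_Int: "xi_sub G \<Longrightarrow> xi_sub H \<Longrightarrow> xi_sub (G \<inter> H)"
  by (auto simp: xi_sub_def)

lemma down_Suc: "(l, Suc j) \<in> down u \<Longrightarrow> (l, j) \<in> down u"
  by (auto simp: down_def dest: Suc_leD)

lemma xi_sub_down: "xi_sub {g. \<forall>k. k \<notin> down u \<longrightarrow> g k = 0}"
  by (rule xi_sub_supported) (rule down_Suc)

lemma xi_sub_Xi_set: "xi_sub Xi_set"
  unfolding xi_sub_def
proof (intro conjI ballI allI)
  show "(\<lambda>_. 0) \<in> Xi_set" by (simp add: Xi_set_def)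
  show "Xi_bmul S u \<in> Xi_set" if "u \<in> Xi_set" for S u
    by (rule Xi_set_subsupp[OF that]) (simp add: Xi_bmul_def down_support)
  show "Xi_a u \<in> Xi_set" if "u \<in> Xi_set" for u
  proof (rule Xi_set_subsupp[OF that])
    have "Xi_a u \<in> {g. \<forall>k. k \<notin> down u \<longrightarrow> g k = 0}"
      by (rule xi_subD(4)[OF xi_sub_down]) (auto simp: down_support)
    then show "Xi_a u k = 0" if "k \<notin> down u" for k using that by blast
  qed
  show "Xi_plus u v \<in> Xi_set" if "u \<in> Xi_set" "v \<in> Xi_set" for u v
  proof -
    have "{k. Xi_plus u v k \<noteq> 0} \<subseteq> {k. u k \<noteq> 0} \<union> {k. v k \<noteq> 0}"
      by (auto simp: Xi_plus_def)
    then have "finite {k. Xi_plus u v k \<noteq> 0}"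
      using that by (auto simp: Xi_set_def intro: finite_subset)
    moreover have "0 < l \<and> l \<le> 1" if "Xi_plus u v (l, j) \<noteq> 0" for l j
    proof -
      have "u (l, j) \<noteq> 0 \<or> v (l, j) \<noteq> 0" using that by (auto simp: Xi_plus_def)
      then show ?thesis using \<open>u \<in> Xi_set\<close> \<open>v \<in> Xi_set\<close> by (auto simp: Xi_set_def)
    qed
    ultimately show ?thesis by (auto simp: Xi_set_def)
  qed
qed

section \<open>Saturation with respect to b\<close>

text \<open>The intersection of \<open>Xi\<close> with the localization of \<open>G\<close> at
  \<open>b\<close>.\<close>

definition xi_sat :: "xi set \<Rightarrow> xi set" where
  "xi_sat G = {u \<in> Xi_set. \<exists>n. Xi_bmul (fps_X ^ n) u \<in> G}"

definition xi_e :: "rat \<times> nat \<Rightarrow> xi" where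
  "xi_e k = (\<lambda>k'. if k' = k then 1 else 0)"

definition Xi_D :: "xi \<Rightarrow> xi" where
  "Xi_D u = (\<lambda>(l, j). fps_const (of_rat l) * u (l, j) + u (l, Suc j) + fps_X * fps_deriv (u (l, j)))"

lemma Xi_a_eq_D: "Xi_a u = Xi_bmul fps_X (Xi_D u)"
  by (rule ext) (auto simp: Xi_a_def Xi_bmul_def Xi_D_def algebra_simps power2_eq_square)

lemma Xi_D_nth:
  "fps_nth (Xi_D u (l, j)) m =
     (of_rat l + of_nat m) * fps_nth (u (l, j)) m + fps_nth (u (l, Suc j)) m"
proof -
  have "fps_nth (fps_X * fps_deriv (u (l, j))) m = of_nat m * fps_nth (u (l, j)) m"
    by (cases m) auto
  then show ?thesis by (simp add: Xi_D_def algebra_simps del: fps_mult_fps_X_commute)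
qed

text \<open>The multiplier is the inverse of the unit part. It normalizes a leading coefficient to a
  pure power of \<open>b\<close>, hence to an eigenvector of \<open>D\<close> up to lower
  logarithmic terms.\<close>

lemma fps_unit_multiple:
  fixes S :: "'a::field fps"
  assumes "S \<noteq> 0"
  obtains U n where "U \<noteq> 0" "U * S = fps_X ^ n"
proof
  have unit: "fps_nth (unit_factor S) 0 \<noteq> 0" using assms by simp
  have "S = fps_X ^ subdegree S * unit_factor S"
    using subdegree_decompose[of S] assms by (simp add: mult.commute)
  then show "inverse (unit_factor S) * S = fps_X ^ subdegree S"
    using inverse_mult_eq_1[OF unit] by (metis mult.left_commute mult.right_neutral)
  then show "inverse (unit_factor S) \<noteq> 0" by auto
qed

lemma sat_Xi_set: "u \<in> xi_sat G \<Longrightarrow> u \<in> Xi_set"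
  by (simp add: xi_sat_def)

lemma sub_sat: "u \<in> G \<Longrightarrow> u \<in> Xi_set \<Longrightarrow> u \<in> xi_sat G"
  unfolding xi_sat_def using Xi_bmul_1 by (auto intro!: exI[of _ 0])

lemma sat_div:
  assumes "Xi_bmul (fps_X ^ n) u \<in> xi_sat G" "u \<in> Xi_set"
  shows "u \<in> xi_sat G"
  using assms by (auto simp: xi_sat_def Xi_bmul_bmul simp flip: power_add)

lemma top_index:
  assumes "u \<in> Xi_set" "u (l, j) \<noteq> 0"
  obtains J where "j \<le> J" "u (l, J) \<noteq> 0" "\<And>i. i > J \<Longrightarrow> u (l, i) = 0"
proof -
  have "finite (Pair l -` {k. u k \<noteq> 0})"
    using assms(1) by (intro finite_vimageI) (auto simp: Xi_set_def inj_on_def)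
  then have fin: "finite {i. u (l, i) \<noteq> 0}" by (simp add: vimage_def)
  define J where "J = Max {i. u (l, i) \<noteq> 0}"
  have "J \<in> {i. u (l, i) \<noteq> 0}" unfolding J_def using fin assms(2) by (intro Max_in) auto
  moreover have "i \<le> J" if "u (l, i) \<noteq> 0" for i unfolding J_def using fin that by simp
  ultimately show ?thesis using that assms(2) by (metis (mono_tags, lifting) linorder_not_le mem_Collect_eq)
qed

text \<open>A nonzero difference of two numbers of ]0,1] lies strictly between -1 and 1, so it is
  not an integer. This keeps the eigenvalues of \<open>D\<close> in different blocks apart.\<close>

lemma rat_diff_nat_nonzero:
  fixes l l' :: rat
  assumes "0 < l" "l \<le> 1" "0 < l'" "l' \<le> 1" "l \<noteq> l'"
  shows "(of_rat (l - l') + of_nat m - of_nat n :: complex) \<noteq> 0"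
proof
  assume *: "(of_rat (l - l') + of_nat m - of_nat n :: complex) = 0"
  have "(of_rat (l - l' + of_int (int m - int n)) :: complex) = 0"
    using * by (simp add: of_rat_add of_rat_diff algebra_simps)
  then have eq: "l - l' + of_int (int m - int n) = 0"
    using of_rat_eq_0_iff by blast
  define z where "z = int m - int n"
  have "of_int z < (1::rat)" "of_int z > (-1::rat)" "of_int z \<noteq> (0::rat)"
    using eq assms unfolding z_def[symmetric] by linarith+
  then show False by simp
qed

section \<open>Stability of the saturation and its basis vectors\<close>

context
  fixes G :: "xi set"
  assumes G: "xi_sub G"
begin

lemma sat_bmul:
  assumes "u \<in> xi_sat G"
  shows "Xi_bmul S u \<in> xi_sat G"
proof -
  obtain n where "Xi_bmul (fps_X ^ n) u \<in> G" "u \<in> Xi_set" using assms by (auto simp: xi_sat_def)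
  then have "Xi_bmul S (Xi_bmul (fps_X ^ n) u) \<in> G" "Xi_bmul S u \<in> Xi_set"
    using G xi_sub_Xi_set xi_subD(3) by blast+
  then show ?thesis by (auto simp: xi_sat_def Xi_bmul_bmul mult.commute)
qed

lemma sat_plus:
  assumes "u \<in> xi_sat G" "v \<in> xi_sat G"
  shows "Xi_plus u v \<in> xi_sat G"
proof -
  obtain n m where nm: "Xi_bmul (fps_X ^ n) u \<in> G" "Xi_bmul (fps_X ^ m) v \<in> G"
    using assms by (auto simp: xi_sat_def)
  have "Xi_bmul (fps_X ^ (n + m)) (Xi_plus u v)
      = Xi_plus (Xi_bmul (fps_X ^ m) (Xi_bmul (fps_X ^ n) u))
                (Xi_bmul (fps_X ^ n) (Xi_bmul (fps_X ^ m) v))"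
    by (simp add: Xi_bmul_plus Xi_bmul_bmul power_add mult.commute)
  also have "\<dots> \<in> G" using nm xi_subD[OF G] by blast
  finally show ?thesis
    using assms xi_subD(2)[OF xi_sub_Xi_set] unfolding xi_sat_def by blast
qed

lemma sat_a:
  assumes "u \<in> xi_sat G"
  shows "Xi_a u \<in> xi_sat G"
proof -
  obtain n where n: "Xi_bmul (fps_X ^ n) u \<in> G" using assms by (auto simp: xi_sat_def)
  \<comment> \<open>Moving \<open>b^n\<close> past \<open>a\<close> costs only the term
    \<open>n b b^n\<close>, so both summands are built from \<open>b^n u\<close>, which lies in
    \<open>G\<close>.\<close>
  have *: "Xi_bmul (fps_X ^ n) (Xi_a u) = Xi_plus (Xi_a (Xi_bmul (fps_X ^ n) u))
      (Xi_bmul (- (of_nat n * fps_X)) (Xi_bmul (fps_X ^ n) u))"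
  proof -
    have "fps_X\<^sup>2 * fps_deriv (fps_X ^ n :: complex fps) = of_nat n * fps_X * fps_X ^ n"
      by (induction n) (simp_all add: power2_eq_square algebra_simps)
    then show ?thesis by (subst bmul_Xi_a) (simp add: Xi_bmul_bmul)
  qed
  have "Xi_bmul (fps_X ^ n) (Xi_a u) \<in> G"
    unfolding * using n xi_subD[OF G] by blast
  then show ?thesis using assms xi_subD(4)[OF xi_sub_Xi_set] by (auto simp: xi_sat_def)
qed

text \<open>Since \<open>a = bD\<close>, stability under \<open>D\<close> asks for a division by
  \<open>b\<close>; the saturation allows it, whereas \<open>G\<close> itself need not be
  stable.\<close>

lemma sat_D:
  assumes "u \<in> xi_sat G"
  shows "Xi_D u \<in> xi_sat G"
proof (rule sat_div[where n = 1])
  show "Xi_bmul (fps_X ^ 1) (Xi_D u) \<in> xi_sat G" using sat_a[OF assms] by (simp add: Xi_a_eq_D)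
  show "Xi_D u \<in> Xi_set"
  proof (rule Xi_set_subsupp[OF sat_Xi_set[OF assms]])
    fix k assume "k \<notin> down u"
    then show "Xi_D u k = 0"
      using down_Suc[of "fst k" "snd k" u] down_support[of _ u]
      by (cases k) (auto simp: Xi_D_def)
  qed
qed

text \<open>The point is an exponent uniform in \<open>u\<close>. Each basis vector brings its own
  exponent, and adding these over the finite set \<open>K\<close> works for all coefficients at
  once.\<close>

lemma coordinate_multiple_mem:
  assumes "finite K" "\<And>k. k \<in> K \<Longrightarrow> xi_e k \<in> xi_sat G"
  shows "\<exists>N. \<forall>u. (\<forall>k. k \<notin> K \<longrightarrow> u k = 0) \<longrightarrow> Xi_bmul (fps_X ^ N) u \<in> G"
  using assms
proof (induction K rule: finite_induct)
  case empty
  have "Xi_bmul (fps_X ^ 0) u \<in> G" if "\<forall>k. k \<notin> {} \<longrightarrow> u k = 0" for u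
  proof -
    have "u = (\<lambda>_. 0)" using that by auto
    then show ?thesis using xi_subD(1)[OF G] by (simp add: Xi_bmul_1)
  qed
  then show ?case by blast
next
  case (insert k K)
  then obtain N where N: "\<And>u. (\<forall>k. k \<notin> K \<longrightarrow> u k = 0) \<Longrightarrow> Xi_bmul (fps_X ^ N) u \<in> G" by auto
  obtain n where n: "Xi_bmul (fps_X ^ n) (xi_e k) \<in> G" using insert.prems[of k] unfolding xi_sat_def by blast
  show ?case
  proof (intro exI allI impI)
    fix u :: xi assume u: "\<forall>k'. k' \<notin> insert k K \<longrightarrow> u k' = 0"
    have "Xi_bmul (fps_X ^ (N + n)) u
        = Xi_plus (Xi_bmul (fps_X ^ n) (Xi_bmul (fps_X ^ N) (u(k := 0))))
                  (Xi_bmul (fps_X ^ N * u k) (Xi_bmul (fps_X ^ n) (xi_e k)))"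
      by (rule ext) (auto simp: Xi_plus_def Xi_bmul_def xi_e_def power_add)
    also have "\<dots> \<in> G"
      using u n N[of "u(k := 0)"] xi_subD[OF G] by auto
    finally show "Xi_bmul (fps_X ^ (N + n)) u \<in> G" .
  qed
qed

lemma sat_supported:
  assumes "u \<in> Xi_set" "\<And>k. u k \<noteq> 0 \<Longrightarrow> xi_e k \<in> xi_sat G"
  shows "u \<in> xi_sat G"
proof -
  have "finite {k. u k \<noteq> 0}" using assms by (simp add: Xi_set_def)
  from coordinate_multiple_mem[OF this] assms show ?thesis by (auto simp: xi_sat_def)
qed

text \<open>Rescale \<open>u\<close> to \<open>w\<close> so that the top coefficient of the block
  \<open>l'\<close> is \<open>b^n\<close>, then apply \<open>D - l' - n\<close>. This kills the top
  term, since nothing above it feeds into it, and creates nothing outside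
  \<open>down u\<close>.\<close>

lemma sat_eliminate:
  assumes u: "u \<in> xi_sat G" and J: "u (l', J) \<noteq> 0" "\<And>i. i > J \<Longrightarrow> u (l', i) = 0"
  obtains n v w where "v \<in> xi_sat G" "card (down v) < card (down u)"
    "w (l', J) = fps_X ^ n" "\<And>k. w k = 0 \<longleftrightarrow> u k = 0"
    "\<And>l j m. fps_nth (v (l, j)) m =
       (of_rat (l - l') + of_nat m - of_nat n) * fps_nth (w (l, j)) m + fps_nth (w (l, Suc j)) m"
proof -
  obtain U n where U: "U \<noteq> 0" "U * u (l', J) = fps_X ^ n"
    using fps_unit_multiple[OF J(1)] by blast
  define w where "w = Xi_bmul U u"
  define v where "v = Xi_plus (Xi_D w) (Xi_bmul (fps_const (- of_rat l' - of_nat n)) w)"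
  have w: "w (l', J) = fps_X ^ n" "\<And>k. w k = 0 \<longleftrightarrow> u k = 0" by (simp_all add: w_def Xi_bmul_def U)
  have "w \<in> xi_sat G" by (simp add: w_def sat_bmul u)
  then have v: "v \<in> xi_sat G" by (simp add: v_def sat_plus sat_bmul sat_D)
  have vn: "fps_nth (v (l, j)) m =
       (of_rat (l - l') + of_nat m - of_nat n) * fps_nth (w (l, j)) m + fps_nth (w (l, Suc j)) m" for l j m
    by (simp add: v_def Xi_plus_def Xi_D_nth Xi_bmul_def of_rat_diff algebra_simps)
  have v0: "v (l, j) = 0" if "u (l, j) = 0" "u (l, Suc j) = 0" for l j
    by (rule fps_ext) (simp add: vn w(2)[THEN iffD2] that)
  have "v (l', i) = 0" if "i \<ge> J" for i
  proof (cases "i = J")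
    case True
    have "w (l', Suc J) = 0" using w(2) J(2) by auto
    then show ?thesis using True w(1) by (intro fps_ext) (simp add: vn fps_X_power_nth)
  next
    case False
    then show ?thesis using that J(2) by (intro v0) auto
  qed
  then have "(l', J) \<notin> down v" by (auto simp: down_def)
  moreover have "down v \<subseteq> down u"
    using v0 Suc_leD le_SucI unfolding down_def by blast
  moreover have "(l', J) \<in> down u" using J(1) by (auto simp: down_def)
  ultimately have "card (down v) < card (down u)"
    using finite_down[OF sat_Xi_set[OF u]] by (intro psubset_card_mono) auto
  then show ?thesis using that v w vn by blast
qed

text \<open>Induction on the size of \<open>down u\<close>. While a second block occurs, eliminating
  its top term preserves the top term of block \<open>l\<close>. With one block left, elimination
  yields the vectors below the top, and subtracting their contribution from \<open>u\<close>
  isolates the top one.\<close>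

lemma sat_basis:
  assumes "u \<in> xi_sat G" "u (l, j) \<noteq> 0" "i \<le> j"
  shows "xi_e (l, i) \<in> xi_sat G"
  using assms
proof (induction "card (down u)" arbitrary: u j i rule: less_induct)
  case less
  note u = less.prems(1)
  have uX: "u \<in> Xi_set" using u by (rule sat_Xi_set)
  obtain J where J: "j \<le> J" "u (l, J) \<noteq> 0" "\<And>i. i > J \<Longrightarrow> u (l, i) = 0"
    using top_index[OF uX less.prems(2)] by blast
  have l01: "0 < l" "l \<le> 1" using uX J(2) by (auto simp: Xi_set_def)
  show ?case
  proof (cases "\<exists>l' j'. l' \<noteq> l \<and> u (l', j') \<noteq> 0")
    case True
    then obtain l' j' where l': "l' \<noteq> l" "u (l', j') \<noteq> 0" by blast
    obtain J' where J': "u (l', J') \<noteq> 0" "\<And>i. i > J' \<Longrightarrow> u (l', i) = 0"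
      using top_index[OF uX l'(2)] by blast
    have l'01: "0 < l'" "l' \<le> 1" using uX J' by (auto simp: Xi_set_def)
    obtain n v w where v: "v \<in> xi_sat G" "card (down v) < card (down u)"
      and w: "\<And>k. w k = 0 \<longleftrightarrow> u k = 0"
      and vn: "\<And>l j m. fps_nth (v (l, j)) m =
       (of_rat (l - l') + of_nat m - of_nat n) * fps_nth (w (l, j)) m + fps_nth (w (l, Suc j)) m"
      by (rule sat_eliminate[OF u J'(1)]) (erule J'(2), rule that)
    obtain m where m: "fps_nth (w (l, J)) m \<noteq> 0"
      using w J(2) by (metis fps_nonzero_nth)
    \<comment> \<open>At the top of block \<open>l\<close> only the factor
      \<open>l - l' + m - n\<close> acts, and it is nonzero.\<close>
    have "w (l, Suc J) = 0" using w J by auto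
    then have "fps_nth (v (l, J)) m \<noteq> 0"
      using m rat_diff_nat_nonzero[OF l01 l'01] l'(1) by (simp add: vn)
    then have "v (l, J) \<noteq> 0" by auto
    then show ?thesis using less.hyps[OF v(2,1)] J(1) less.prems(3) by auto
  next
    case False
    then have only: "\<And>l1 j1. l1 \<noteq> l \<Longrightarrow> u (l1, j1) = 0" by blast
    have lower: "xi_e (l, i) \<in> xi_sat G" if iJ: "i < J" for i
    proof -
      obtain n v w where v: "v \<in> xi_sat G" "card (down v) < card (down u)" and w: "w (l, J) = fps_X ^ n"
        and vn: "\<And>l1 j m. fps_nth (v (l1, j)) m =
         (of_rat (l1 - l) + of_nat m - of_nat n) * fps_nth (w (l1, j)) m + fps_nth (w (l1, Suc j)) m"
        by (rule sat_eliminate[OF u J(2)]) (erule J(3), rule that)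
      obtain J0 where J0: "J = Suc J0" using iJ by (cases J) auto
      \<comment> \<open>At order \<open>n\<close> the factor \<open>l - l + n - n\<close> vanishes,
        and what remains is the coefficient 1 of \<open>b^n\<close> coming from index
        \<open>J\<close>.\<close>
      have "fps_nth (v (l, J0)) n = 1" using w by (simp add: vn J0)
      then have "v (l, J0) \<noteq> 0" by auto
      then show ?thesis using less.hyps[OF v(2,1)] iJ J0 by auto
    qed
    have top: "xi_e (l, J) \<in> xi_sat G"
    proof -
      define r where "r = u((l, J) := 0)"
      have "r \<in> Xi_set" by (rule Xi_set_subsupp[OF uX]) (simp add: r_def down_support)
      moreover have "xi_e k \<in> xi_sat G" if "r k \<noteq> 0" for k
      proof -
        obtain l1 j1 where k: "k = (l1, j1)" by (cases k)
        have "u k \<noteq> 0" "k \<noteq> (l, J)" using that by (auto simp: r_def split: if_splits)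
        then have "l1 = l" "j1 < J" using only J(3) k by (metis, metis linorder_neqE_nat)
        then show ?thesis using lower k by simp
      qed
      ultimately have "r \<in> xi_sat G" by (rule sat_supported)
      then have "Xi_plus u (Xi_bmul (-1) r) \<in> xi_sat G" by (intro sat_plus sat_bmul u)
      moreover have "Xi_plus u (Xi_bmul (-1) r) = Xi_bmul (u (l, J)) (xi_e (l, J))"
        by (rule ext) (auto simp: Xi_plus_def Xi_bmul_def r_def xi_e_def)
      ultimately have S: "Xi_bmul (u (l, J)) (xi_e (l, J)) \<in> xi_sat G" by simp
      obtain U n where U: "U * u (l, J) = fps_X ^ n"
        using fps_unit_multiple[OF J(2)] by blast
      have "Xi_bmul (fps_X ^ n) (xi_e (l, J)) \<in> xi_sat G"
        using sat_bmul[OF S, of U] by (simp add: Xi_bmul_bmul U)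
      moreover have "xi_e (l, J) \<in> Xi_set"
        using l01 by (auto simp: Xi_set_def xi_e_def)
      ultimately show ?thesis by (rule sat_div)
    qed
    show ?thesis
      using lower top less.prems(3) J(1) by (cases "i = J") auto
  qed
qed

end

section \<open>The module generated by an element of Xi\<close>

text \<open>This is the submodule of multiples of \<open>b^N\<close>; it shows that the term of
  index \<open>\<nu>\<close> in a series affects only orders at least \<open>\<nu>\<close>.\<close>

lemma xi_sub_divisible: "xi_sub {u. \<forall>k. \<forall>n<N. fps_nth (u k) n = 0}"
  unfolding xi_sub_def
proof (intro conjI ballI allI)
  fix S :: "complex fps" and u :: xi
  assume "u \<in> {u. \<forall>k. \<forall>n<N. fps_nth (u k) n = 0}"
  then show "Xi_bmul S u \<in> {u. \<forall>k. \<forall>n<N. fps_nth (u k) n = 0}"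
    by (auto simp: Xi_bmul_def fps_mult_nth intro!: sum.neutral)
qed (auto simp: Xi_plus_def Xi_a_nth)

lemma Xi_polyop_pow_nth:
  assumes "n < \<nu>"
  shows "fps_nth (Xi_polyop P (Xi_bmul (fps_X ^ \<nu>) u) k) n = 0"
proof -
  have "Xi_bmul (fps_X ^ \<nu>) u \<in> {u. \<forall>k. \<forall>n<\<nu>. fps_nth (u k) n = 0}"
    by (simp add: Xi_bmul_def fps_X_power_mult_nth)
  from Xi_polyop_mem[OF xi_sub_divisible this] assms show ?thesis by blast
qed

section \<open>Polynomials in \<open>a\<close>\<close>

lemma Xi_polyop_le:
  assumes "degree P \<le> N"
  shows "Xi_polyop P u k = (\<Sum>i\<le>N. fps_const (coeff P i) * (Xi_a ^^ i) u k)"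
  unfolding Xi_polyop_def using assms
  by (intro sum.mono_neutral_left) (auto simp: coeff_eq_0)

lemma Xi_polyop_add: "Xi_polyop (P + Q) u = Xi_plus (Xi_polyop P u) (Xi_polyop Q u)"
proof
  fix k
  let ?N = "max (degree P) (degree Q)"
  show "Xi_polyop (P + Q) u k = Xi_plus (Xi_polyop P u) (Xi_polyop Q u) k"
    unfolding Xi_plus_def
    by (subst (1 2 3) Xi_polyop_le[where N = ?N])
       (auto simp: degree_add_le sum.distrib distrib_right simp flip: fps_const_add)
qed

lemma Xi_polyop_pCons_0: "Xi_polyop (pCons 0 P) u = Xi_a (Xi_polyop P u)"
proof
  fix k :: "rat \<times> nat"
  obtain l j where k: "k = (l, j)" by (cases k)
  have "Xi_polyop (pCons 0 P) u k = (\<Sum>i\<le>Suc (degree P). fps_const (coeff (pCons 0 P) i) * (Xi_a ^^ i) u k)"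
    by (intro Xi_polyop_le) (rule degree_pCons_le)
  also have "\<dots> = (\<Sum>i\<le>degree P. fps_const (coeff P i) * Xi_a ((Xi_a ^^ i) u) k)"
    by (subst sum.atMost_Suc_shift) simp
  also have "\<dots> = Xi_a (Xi_polyop P u) k"
    unfolding k
  proof (rule fps_ext)
    fix n
    show "fps_nth (\<Sum>i\<le>degree P. fps_const (coeff P i) * Xi_a ((Xi_a ^^ i) u) (l, j)) n
        = fps_nth (Xi_a (Xi_polyop P u) (l, j)) n"
      by (cases n) (simp_all add: fps_sum_nth Xi_a_nth Xi_polyop_def sum_distrib_left sum.distrib
          distrib_left mult.left_commute)
  qed
  finally show "Xi_polyop (pCons 0 P) u k = Xi_a (Xi_polyop P u) k" .
qed

lemma Xi_polyop_const: "Xi_polyop [:c:] u = Xi_bmul (fps_const c) u"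
  by (simp add: Xi_polyop_def Xi_bmul_def)

section \<open>Series acting on an element, and their span\<close>

lemma Atil_act_nth:
  "fps_nth (Atil_act P u k) n = (\<Sum>\<nu>\<le>n. fps_nth (Xi_polyop (P \<nu>) (Xi_bmul (fps_X ^ \<nu>) u) k) n)"
  by (simp add: Atil_act_def)

lemma Atil_act_add:
  "Xi_plus (Atil_act P u) (Atil_act Q u) = Atil_act (\<lambda>\<nu>. P \<nu> + Q \<nu>) u"
  by (intro ext fps_ext) (simp add: Xi_plus_def Atil_act_nth Xi_polyop_add sum.distrib)

lemma Atil_act_a: "Xi_a (Atil_act P u) = Atil_act (\<lambda>\<nu>. pCons 0 (P \<nu>)) u"
proof (intro ext fps_ext)
  fix k :: "rat \<times> nat" and n
  obtain l j where k: "k = (l, j)" by (cases k)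
  show "fps_nth (Xi_a (Atil_act P u) k) n = fps_nth (Atil_act (\<lambda>\<nu>. pCons 0 (P \<nu>)) u k) n"
    \<comment> \<open>At order \<open>n > 0\<close> the right-hand sum has the extra index
      \<open>\<nu> = n\<close>; its term vanishes, being \<open>a\<close> applied to a multiple of
      \<open>b^n\<close>.\<close>
    by (cases n) (simp_all add: k Xi_a_nth Atil_act_nth Xi_polyop_pCons_0 Xi_polyop_pow_nth
        sum_distrib_left sum.distrib del: power_Suc)
qed

lemma Atil_act_const: "Atil_act (\<lambda>\<nu>. [:fps_nth S \<nu>:]) u = Xi_bmul S u"
proof (intro ext fps_ext)
  fix k n
  have "fps_nth (Atil_act (\<lambda>\<nu>. [:fps_nth S \<nu>:]) u k) n = (\<Sum>\<nu>\<le>n. fps_nth S \<nu> * fps_nth (u k) (n - \<nu>))"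
    by (auto simp: Atil_act_nth Xi_polyop_const Xi_bmul_def fps_X_power_mult_nth intro!: sum.cong)
  then show "fps_nth (Atil_act (\<lambda>\<nu>. [:fps_nth S \<nu>:]) u k) n = fps_nth (Xi_bmul S u k) n"
    by (simp add: Xi_bmul_def fps_mult_nth atLeast0AtMost)
qed

lemma Atil_span_plus:
  "v \<in> Atil_span u \<Longrightarrow> w \<in> Atil_span u \<Longrightarrow> Xi_plus v w \<in> Atil_span u"
  using Atil_act_add by (force simp: Atil_span_def)

lemma Atil_span_a: "v \<in> Atil_span u \<Longrightarrow> Xi_a v \<in> Atil_span u"
  using Atil_act_a by (force simp: Atil_span_def)

text \<open>An infinite series stays in \<open>G\<close> because, inside the finite support of
  \<open>\<psi>\<close>, the submodule contains \<open>b^N\<close> times every family with its own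
  support. The first \<open>N\<close> terms lie in \<open>G\<close> algebraically, and the tail is
  such a multiple.\<close>

lemma Atil_span_least:
  assumes G: "xi_sub G" and \<psi>: "\<psi> \<in> G" "\<psi> \<in> Xi_set"
  shows "Atil_span \<psi> \<subseteq> G"
proof
  fix u assume "u \<in> Atil_span \<psi>"
  then obtain P where u: "u = Atil_act P \<psi>" by (auto simp: Atil_span_def)
  define K where "K = down \<psi>"
  \<comment> \<open>\<open>G\<close> may have unbounded support; cutting down to
    \<open>down \<psi>\<close> makes the set of relevant basis vectors finite.\<close>
  define G0 where "G0 = G \<inter> {g. \<forall>k. k \<notin> K \<longrightarrow> g k = 0}"
  have finK: "finite K" unfolding K_def by (rule finite_down[OF \<psi>(2)])
  have G0: "xi_sub G0"
    unfolding G0_def K_def using G by (intro xi_sub_Int xi_sub_down)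
  have \<psi>0: "\<psi> \<in> G0" using \<psi> by (auto simp: G0_def K_def down_support)
  have G0_Xi: "g \<in> Xi_set" if "g \<in> G0" for g
    using that by (intro Xi_set_subsupp[OF \<psi>(2)]) (auto simp: G0_def K_def)
  define K' where "K' = {k \<in> K. xi_e k \<in> xi_sat G0}"
  have supp: "g k = 0" if "g \<in> G0" "k \<notin> K'" for g k
  proof (rule ccontr)
    assume "g k \<noteq> 0"
    moreover obtain l j where "k = (l, j)" by (cases k)
    ultimately have "xi_e k \<in> xi_sat G0"
      using sat_basis[OF G0 sub_sat[OF that(1) G0_Xi[OF that(1)]]] by auto
    moreover have "k \<in> K" using \<open>g k \<noteq> 0\<close> that(1) unfolding G0_def by blast
    ultimately show False using that(2) by (simp add: K'_def)
  qed
  have "finite K'" "\<And>k. k \<in> K' \<Longrightarrow> xi_e k \<in> xi_sat G0" using finK by (simp_all add: K'_def)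
  then obtain N where N: "\<And>u. (\<forall>k. k \<notin> K' \<longrightarrow> u k = 0) \<Longrightarrow> Xi_bmul (fps_X ^ N) u \<in> G0"
    using coordinate_multiple_mem[OF G0, of K'] by blast
  define t where "t \<nu> = Xi_polyop (P \<nu>) (Xi_bmul (fps_X ^ \<nu>) \<psi>)" for \<nu>
  have t: "t \<nu> \<in> G0" for \<nu>
    unfolding t_def by (intro Xi_polyop_mem[OF G0] xi_subD(3)[OF G0] \<psi>0)
  define p where "p = (\<lambda>k. \<Sum>\<nu><N. t \<nu> k)"
  have p: "p \<in> G0" unfolding p_def by (intro xi_sub_sum[OF G0] t) auto
  \<comment> \<open>By \<open>low\<close> below, \<open>u - p\<close> has order at least
    \<open>N\<close> in every coordinate, so the shift is an exact division by
    \<open>b^N\<close>.\<close>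
  define q where "q = (\<lambda>k. fps_shift N (u k - p k))"
  have low: "fps_nth (u k) n = fps_nth (p k) n" if "n < N" for k n
  proof -
    have "fps_nth (p k) n = (\<Sum>\<nu><N. fps_nth (t \<nu> k) n)" by (simp add: p_def fps_sum_nth)
    \<comment> \<open>The dropped indices satisfy \<open>n < \<nu> < N\<close> and do not reach
      order \<open>n\<close>.\<close>
    also have "\<dots> = (\<Sum>\<nu>\<le>n. fps_nth (t \<nu> k) n)"
      using that by (intro sum.mono_neutral_right) (auto simp: t_def Xi_polyop_pow_nth)
    finally show ?thesis by (simp add: u Atil_act_nth t_def)
  qed
  have "q k = 0" if "k \<notin> K'" for k
  proof -
    have "u k = 0" using supp[OF t that] by (intro fps_ext) (simp add: u Atil_act_nth flip: t_def)
    then show ?thesis using supp[OF p that] by (simp add: q_def)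
  qed
  then have "Xi_bmul (fps_X ^ N) q \<in> G0" using N by blast
  then have "Xi_plus p (Xi_bmul (fps_X ^ N) q) \<in> G0" using p xi_subD(2)[OF G0] by blast
  also have "Xi_plus p (Xi_bmul (fps_X ^ N) q) = u"
    by (intro ext fps_ext) (auto simp: Xi_plus_def Xi_bmul_def q_def fps_X_power_mult_nth low)
  finally show "u \<in> G" by (simp add: G0_def)
qed

text \<open>Stability under power series is not visible in the formula, as \<open>S\<close> stands
  to the left of the polynomials in \<open>a\<close>. The elements all of whose multiples stay in
  the span form a submodule containing \<open>\<psi>\<close>, so by minimality they are the whole
  span.\<close>

lemma Atil_span_sub:
  assumes "\<psi> \<in> Xi_set"
  shows "xi_sub (Atil_span \<psi>)" and Atil_span_self: "\<psi> \<in> Atil_span \<psi>"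
proof -
  define G where "G = {u. \<forall>S. Xi_bmul S u \<in> Atil_span \<psi>}"
  have base: "Xi_bmul S \<psi> \<in> Atil_span \<psi>" for S
    using Atil_act_const[of S \<psi>] by (metis Atil_span_def rangeI)
  have "Xi_bmul 0 \<psi> = (\<lambda>_. 0)" by (simp add: Xi_bmul_def)
  with base have "(\<lambda>_. 0) \<in> Atil_span \<psi>" by metis
  then have "xi_sub G"
    unfolding xi_sub_def G_def
    by (auto simp: Xi_bmul_plus Xi_bmul_bmul bmul_Xi_a Atil_span_plus Atil_span_a)
       (simp add: Xi_bmul_def)
  moreover have "\<psi> \<in> G" using base by (simp add: G_def)
  moreover have "G \<subseteq> Atil_span \<psi>" unfolding G_def by (metis (mono_tags) Xi_bmul_1 mem_Collect_eq subsetI)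
  ultimately show "xi_sub (Atil_span \<psi>)" "\<psi> \<in> Atil_span \<psi>"
    using Atil_span_least[OF _ _ assms, of G] by (auto intro: subset_antisym)
qed

section \<open>Shifts of logarithmic degree\<close>

definition xi_shift :: "(rat \<Rightarrow> nat) \<Rightarrow> xi \<Rightarrow> xi" where
  "xi_shift m u = (\<lambda>(l, j). u (l, j + m l))"

lemma xi_shift_plus: "xi_shift m (Xi_plus u v) = Xi_plus (xi_shift m u) (xi_shift m v)"
  by (auto simp: xi_shift_def Xi_plus_def)

lemma xi_shift_bmul: "xi_shift m (Xi_bmul S u) = Xi_bmul S (xi_shift m u)"
  by (auto simp: xi_shift_def Xi_bmul_def)

text \<open>Within a block the coefficients defining \<open>a\<close> do not depend on
  \<open>j\<close>, so renumbering the logarithmic degree commutes with it.\<close>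

lemma xi_shift_a: "xi_shift m (Xi_a u) = Xi_a (xi_shift m u)"
  by (auto simp: xi_shift_def Xi_a_def)

lemma xi_shift_polyop: "Xi_polyop P (xi_shift m u) = xi_shift m (Xi_polyop P u)"
proof -
  have "(Xi_a ^^ i) (xi_shift m u) = xi_shift m ((Xi_a ^^ i) u)" for i
    by (induction i) (auto simp: xi_shift_a)
  then show ?thesis by (auto simp: Xi_polyop_def xi_shift_def)
qed

lemma xi_shift_Atil_act: "xi_shift m (Atil_act P u) = Atil_act P (xi_shift m u)"
proof (intro ext fps_ext)
  fix k :: "rat \<times> nat" and n
  obtain l j where "k = (l, j)" by (cases k)
  then show "fps_nth (xi_shift m (Atil_act P u) k) n = fps_nth (Atil_act P (xi_shift m u) k) n"
    by (simp add: Atil_act_nth xi_shift_polyop flip: xi_shift_bmul) (simp add: xi_shift_def Atil_act_nth)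
qed

lemma xi_shift_Atil_span: "xi_shift m ` Atil_span u = Atil_span (xi_shift m u)"
  by (auto simp: Atil_span_def xi_shift_Atil_act image_iff)

lemma xi_shift_Xi_set:
  assumes "u \<in> Xi_set"
  shows "xi_shift m u \<in> Xi_set"
proof (rule Xi_set_subsupp[OF assms])
  fix k assume "k \<notin> down u"
  then show "xi_shift m u k = 0" by (cases k) (auto simp: down_def xi_shift_def)
qed

text \<open>For each block, \<open>m l\<close> is the first logarithmic degree from which all of
  \<open>G\<close> vanishes. Elements of \<open>V\<close> killed by the shift then lie in the
  saturation of \<open>G\<close>, and normality removes the power of \<open>b\<close>.\<close>

lemma normal_eq_kernel:
  assumes V: "V \<subseteq> {v. \<forall>k. k \<notin> K \<longrightarrow> v k = 0}" "finite K" "V \<subseteq> Xi_set"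
    and G: "xi_sub G" "G \<subseteq> V"
    and V_bmul: "\<And>S v. v \<in> V \<Longrightarrow> Xi_bmul S v \<in> V"
    and normal: "G \<inter> Xi_bmul fps_X ` V \<subseteq> Xi_bmul fps_X ` G"
  obtains m where "\<And>u. u \<in> V \<Longrightarrow> u \<in> G \<longleftrightarrow> xi_shift m u = (\<lambda>_. 0)"
proof
  define m where "m = (\<lambda>l. LEAST n. \<forall>u\<in>G. \<forall>j\<ge>n. u (l, j) = 0)"
  have bound: "\<exists>n. \<forall>u\<in>G. \<forall>j\<ge>n. u (l, j) = 0" for l
  proof -
    have "finite (snd ` K)" using V(2) by simp
    then obtain n where "\<forall>i\<in>snd ` K. i < n" by (metis finite_nat_set_iff_bounded)
    then have "(l, j) \<notin> K" if "j \<ge> n" for j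
      using that by (metis image_eqI leD snd_conv)
    then show ?thesis using V(1) G(2) by blast
  qed
  have above: "u (l, j) = 0" if "u \<in> G" "j \<ge> m l" for u l j
    using LeastI_ex[OF bound, of l] that unfolding m_def by blast
  have below: "xi_e (l, i) \<in> xi_sat G" if "i < m l" for l i
  proof -
    \<comment> \<open>Minimality of \<open>m l\<close> supplies an element of \<open>G\<close> with
      a nonzero coefficient at or above \<open>i\<close>.\<close>
    have "\<not> (\<forall>u\<in>G. \<forall>j\<ge>i. u (l, j) = 0)"
      using that unfolding m_def by (rule not_less_Least)
    then obtain u j where u: "u \<in> G" "i \<le> j" "u (l, j) \<noteq> 0" by blast
    then have "u \<in> xi_sat G" using G V(3) by (intro sub_sat) auto
    then show ?thesis using sat_basis[OF G(1)] u by blast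
  qed
  show "u \<in> G \<longleftrightarrow> xi_shift m u = (\<lambda>_. 0)" if u: "u \<in> V" for u
  proof
    assume "u \<in> G"
    then show "xi_shift m u = (\<lambda>_. 0)" by (auto simp: xi_shift_def above)
  next
    assume ker: "xi_shift m u = (\<lambda>_. 0)"
    have "xi_e k \<in> xi_sat G" if "u k \<noteq> 0" for k
    proof -
      obtain l j where k: "k = (l, j)" by (cases k)
      have "j < m l"
      proof (rule ccontr)
        assume "\<not> j < m l"
        then show False using fun_cong[OF ker, of "(l, j - m l)"] that k by (simp add: xi_shift_def)
      qed
      then show ?thesis using below k by simp
    qed
    then have "u \<in> xi_sat G" using u V(3) sat_supported[OF G(1), of u] by blast
    then obtain n where "Xi_bmul (fps_X ^ n) u \<in> G" by (auto simp: xi_sat_def)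
    then show "u \<in> G"
    proof (induction n)
      case 0
      then show ?case by (simp add: Xi_bmul_1)
    next
      case (Suc n)
      \<comment> \<open>Powers of \<open>b\<close> are removed one at a time: \<open>b^n u\<close>
        lies in \<open>V\<close>, its product with \<open>b\<close> lies in \<open>G\<close>, and
        multiplication by \<open>b\<close> is injective.\<close>
      have eq: "Xi_bmul (fps_X ^ Suc n) u = Xi_bmul fps_X (Xi_bmul (fps_X ^ n) u)"
        by (simp add: Xi_bmul_bmul)
      then have "Xi_bmul fps_X (Xi_bmul (fps_X ^ n) u) \<in> Xi_bmul fps_X ` G"
        using Suc.prems V_bmul[OF u] normal by auto
      then have "Xi_bmul (fps_X ^ n) u \<in> G" by (auto simp: Xi_bmul_eq_iff)
      then show ?case by (rule Suc.IH)
    qed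
  qed
qed

section \<open>Submodules and quotients of themes\<close>

theorem theorem3p3:
  fixes E :: "'m abmod" and F :: "'m set"
  assumes "theme E"
    and "is_sub E F"
    and "monogenic E F"
  shows "theme (E\<lparr>ab_carrier := F\<rparr>) \<and> (normal_sub E F \<longrightarrow> theme (quotient E F))"
proof -
  let ?C = "ab_carrier E"
  obtain \<phi> f where \<phi>: "\<phi> \<in> Xi_set" and bij: "bij_betw f ?C (Atil_span \<phi>)"
    and f0: "f (ab_zero E) = (\<lambda>_. 0)"
    and fplus: "\<And>x y. x \<in> ?C \<Longrightarrow> y \<in> ?C \<Longrightarrow> f (ab_plus E x y) = Xi_plus (f x) (f y)"
    and fbmul: "\<And>S x. x \<in> ?C \<Longrightarrow> f (ab_bmul E S x) = Xi_bmul S (f x)"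
    and fa: "\<And>x. x \<in> ?C \<Longrightarrow> f (ab_aop E x) = Xi_a (f x)"
    using assms(1) unfolding theme_def by blast
  have C: "ab_zero E \<in> ?C" "\<And>x y. x \<in> ?C \<Longrightarrow> y \<in> ?C \<Longrightarrow> ab_plus E x y \<in> ?C"
    "\<And>S x. x \<in> ?C \<Longrightarrow> ab_bmul E S x \<in> ?C" "\<And>x. x \<in> ?C \<Longrightarrow> ab_aop E x \<in> ?C"
    using assms(1) unfolding theme_def ab_closed_def by blast+
  have F: "F \<subseteq> ?C" "ab_zero E \<in> F" "\<And>x y. x \<in> F \<Longrightarrow> y \<in> F \<Longrightarrow> ab_plus E x y \<in> F"
    "\<And>S x. x \<in> F \<Longrightarrow> ab_bmul E S x \<in> F" "\<And>x. x \<in> F \<Longrightarrow> ab_aop E x \<in> F"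
    using assms(2) unfolding is_sub_def by blast+
  have inj: "inj_on f ?C" and im: "f ` ?C = Atil_span \<phi>" using bij by (auto simp: bij_betw_def)
  have span_Xi: "Atil_span \<phi> \<subseteq> Xi_set" by (rule Atil_span_least[OF xi_sub_Xi_set \<phi> \<phi>])
  have fF: "xi_sub (f ` F)"
    unfolding xi_sub_def
  proof (intro conjI ballI allI)
    show "(\<lambda>_. 0) \<in> f ` F" using F(2) f0 by (metis image_eqI)
    fix u assume "u \<in> f ` F"
    then obtain x where x: "x \<in> F" "x \<in> ?C" "u = f x" using F(1) by blast
    show "Xi_bmul S u \<in> f ` F" for S using x F(4) fbmul by (metis image_eqI)
    show "Xi_a u \<in> f ` F" using x F(5) fa by (metis image_eqI)
    fix v assume "v \<in> f ` F"
    then obtain y where y: "y \<in> F" "y \<in> ?C" "v = f y" using F(1) by blast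
    show "Xi_plus u v \<in> f ` F" using x y F(3) fplus by (metis image_eqI)
  qed

  \<comment> \<open>The monogenic submodule\<close>
  have sub: "theme (E\<lparr>ab_carrier := F\<rparr>)"
  proof -
    obtain x where x: "x \<in> F" "F = generated E x" using assms(3) by (auto simp: monogenic_def)
    have fx: "f x \<in> Xi_set" using x(1) F(1) im span_Xi by blast
    \<comment> \<open>The preimage of the span of \<open>f x\<close> is a submodule containing
      \<open>x\<close>, hence contains \<open>F\<close>; minimality of the span gives the other
      inclusion.\<close>
    let ?H = "{y \<in> ?C. f y \<in> Atil_span (f x)}"
    have "is_sub E ?H"
      unfolding is_sub_def
      using C f0 fplus fbmul fa xi_subD[OF Atil_span_sub(1)[OF fx]] by auto
    moreover have "x \<in> ?H" using x F(1) Atil_span_self[OF fx] by auto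
    ultimately have "F \<subseteq> ?H" unfolding x(2) generated_def by blast
    moreover have "Atil_span (f x) \<subseteq> f ` F" using fF x fx by (intro Atil_span_least) auto
    ultimately have "f ` F = Atil_span (f x)" by auto
    then have "bij_betw f F (Atil_span (f x))"
      using inj F(1) by (auto simp: bij_betw_def intro: inj_on_subset)
    then show ?thesis
      unfolding theme_def ab_closed_def
      using F(2-) subsetD[OF F(1)] fx f0 fplus fbmul fa by (auto intro!: bexI[of _ "f x"] exI[of _ f])
  qed

  \<comment> \<open>The quotient by a normal submodule\<close>
  have "theme (quotient E F)" if normal: "normal_sub E F"
  proof -
    have "f ` F \<inter> Xi_bmul fps_X ` Atil_span \<phi> \<subseteq> Xi_bmul fps_X ` f ` F"
    proof
      fix u assume "u \<in> f ` F \<inter> Xi_bmul fps_X ` Atil_span \<phi>"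
      then obtain x y where xy: "x \<in> F" "u = f x" "y \<in> ?C" "u = Xi_bmul fps_X (f y)"
        unfolding im[symmetric] by blast
      then have "f x = f (ab_bmul E fps_X y)" using fbmul by simp
      then have "x = ab_bmul E fps_X y" using inj xy F(1) C(3) by (meson inj_onD subsetD)
      then have "x \<in> ab_bmul E fps_X ` F"
        using normal xy unfolding normal_sub_def by blast
      then show "u \<in> Xi_bmul fps_X ` f ` F" using xy F(1) fbmul by auto
    qed
    moreover have "Atil_span \<phi> \<subseteq> {v. \<forall>k. k \<notin> down \<phi> \<longrightarrow> v k = 0}"
      by (rule Atil_span_least[OF xi_sub_down _ \<phi>]) (auto simp: down_support)
    moreover have "f ` F \<subseteq> Atil_span \<phi>" using F(1) im by blast
    ultimately obtain m where m: "\<And>u. u \<in> Atil_span \<phi> \<Longrightarrow> u \<in> f ` F \<longleftrightarrow> xi_shift m u = (\<lambda>_. 0)"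
      using normal_eq_kernel[OF _ finite_down[OF \<phi>] span_Xi fF] xi_subD(3)[OF Atil_span_sub(1)[OF \<phi>]]
      by blast
    \<comment> \<open>\<open>h\<close> is the map that will descend to the quotient; its kernel is
      \<open>F\<close>.\<close>
    define h where "h = (\<lambda>x. xi_shift m (f x))"
    have h0: "h x = (\<lambda>_. 0) \<longleftrightarrow> x \<in> F" if "x \<in> ?C" for x
      using m[of "f x"] that im inj F(1) unfolding h_def
      by (metis image_eqI inj_on_image_mem_iff)
    have hplus: "h (ab_plus E x y) = Xi_plus (h x) (h y)" if "x \<in> ?C" "y \<in> ?C" for x y
      using that by (simp add: h_def fplus xi_shift_plus)
    have hbmul: "h (ab_bmul E S x) = Xi_bmul S (h x)" if "x \<in> ?C" for S x
      using that by (simp add: h_def fbmul xi_shift_bmul)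
    have ha: "h (ab_aop E x) = Xi_a (h x)" if "x \<in> ?C" for x
      using that by (simp add: h_def fa xi_shift_a)
    have coset_iff: "z \<in> coset E F x \<longleftrightarrow> z \<in> ?C \<and> h z = h x" if x: "x \<in> ?C" for x z
    proof
      assume "z \<in> coset E F x"
      then obtain y where y: "y \<in> F" "z = ab_plus E x y" by (auto simp: coset_def)
      then have "h y = (\<lambda>_. 0)" using h0 F(1) by blast
      then show "z \<in> ?C \<and> h z = h x" using y x F(1) C(2) hplus by (auto simp: Xi_plus_def)
    next
      assume z: "z \<in> ?C \<and> h z = h x"
      \<comment> \<open>This is \<open>z - x\<close>, formed with the scalar -1. The identity
        \<open>x + y = z\<close> is checked in \<open>Xi\<close> and pulled back by injectivity of
        \<open>f\<close>.\<close>
      define y where "y = ab_plus E z (ab_bmul E (-1) x)"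
      have yC: "y \<in> ?C" using z x C by (simp add: y_def)
      have "h y = (\<lambda>_. 0)"
        using z x C by (simp add: y_def hplus hbmul) (simp add: Xi_plus_def Xi_bmul_def)
      then have "y \<in> F" using h0 yC by blast
      moreover have "f (ab_plus E x y) = f z"
        using z x C yC by (simp add: fplus) (simp add: y_def fplus fbmul C Xi_plus_def Xi_bmul_def)
      then have "ab_plus E x y = z" using inj C(2) x yC z by (meson inj_onD)
      ultimately show "z \<in> coset E F x" by (auto simp: coset_def)
    qed
    \<comment> \<open>The quotient operations use these chosen representatives; \<open>h\<close> is
      constant on cosets, so the choice does not affect its values.\<close>
    define r :: "'m set \<Rightarrow> 'm" where "r X = (SOME x. x \<in> X)" for X
    have Q: "quotient E F = \<lparr> ab_carrier = coset E F ` ?C,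
        ab_plus = (\<lambda>X Y. coset E F (ab_plus E (r X) (r Y))), ab_zero = coset E F (ab_zero E),
        ab_bmul = (\<lambda>S X. coset E F (ab_bmul E S (r X))), ab_aop = (\<lambda>X. coset E F (ab_aop E (r X))) \<rparr>"
      by (simp add: quotient_def r_def)
    have r: "r (coset E F x) \<in> ?C" "h (r (coset E F x)) = h x" if "x \<in> ?C" for x
    proof -
      have "x \<in> coset E F x" using coset_iff that by blast
      then have "r (coset E F x) \<in> coset E F x" unfolding r_def by (rule someI)
      then show "r (coset E F x) \<in> ?C" "h (r (coset E F x)) = h x" using coset_iff that by blast+
    qed
    have coset_eq: "coset E F x = coset E F y" if "x \<in> ?C" "y \<in> ?C" "h x = h y" for x y
      by (rule set_eqI) (simp add: coset_iff[OF that(1)] coset_iff[OF that(2)] that(3))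
    define g where "g = (\<lambda>X. h (r X))"
    have g: "g (coset E F x) = h x" if "x \<in> ?C" for x using r(2)[OF that] by (simp add: g_def)
    have "bij_betw g (coset E F ` ?C) (Atil_span (xi_shift m \<phi>))"
      unfolding bij_betw_def
    proof
      show "inj_on g (coset E F ` ?C)" 
      proof (rule inj_onI)
        fix X Y assume "X \<in> coset E F ` ?C" "Y \<in> coset E F ` ?C" "g X = g Y"
        then obtain x y where "x \<in> ?C" "y \<in> ?C" "X = coset E F x" "Y = coset E F y" by blast
        with \<open>g X = g Y\<close> show "X = Y" using g coset_eq[of x y] by simp
      qed
      \<comment> \<open>The image is that of the span of \<open>\<phi>\<close> under the shift,
        which is the span of the shifted generator.\<close>
      have "g ` coset E F ` ?C = xi_shift m ` f ` ?C"
        unfolding image_image using g by (auto simp: h_def intro!: image_cong)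
      then show "g ` coset E F ` ?C = Atil_span (xi_shift m \<phi>)"
        by (simp add: im xi_shift_Atil_span)
    qed
    moreover have "h (ab_zero E) = (\<lambda>_. 0)" using h0 C(1) F(2) by blast
    moreover have "ab_closed (quotient E F)"
      unfolding ab_closed_def Q using C r by auto
    ultimately show ?thesis
      unfolding theme_def
      using C r xi_shift_Xi_set[OF \<phi>, of m]
      by (intro conjI bexI[of _ "xi_shift m \<phi>"] exI[of _ g])
         (auto simp: Q g hplus hbmul ha)
  qed
  with sub show ?thesis by blast
qed

end
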